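(* Let $p\in(-\infty,-1]\cup[0,\infty)$. Both of the inequalities $$\frac{2G+(1+3p)A}{(3+p)G+2pA}\,G<L,\qquad \frac{2A+(1+3p)Q}{(3+p)A+2pQ}\,A<NS$$ hold for all $a,b>0$ with $a\ne b$ if and only if $p\in(-\infty,-1]\cup\left[\frac19,\infty\right)$. Both of them are reversed for all $a,b>0$ with $a\neq b$ if and only if $p=0$.
   Context: For $a,b>0$ with $a\ne b$: $L=\dfrac{a-b}{\ln a-\ln b}$ is the logarithmic mean, $NS=NS(a,b)=\dfrac{a-b}{2\,\mathrm{arcsinh}\frac{a-b}{a+b}}$ is the Neuman–Sándor mean, and $A=\frac{a+b}{2}$, $G=\sqrt{ab}$, $Q=\sqrt{\frac{a^2+b^2}{2}}$ are the arithmetic, geometric and quadratic means. The phrase "both" refers to the conjunction of the two displayed inequalities. *)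

theory Defs
  imports Complex_Main
begin

text \<open>The means are only meant for positive \<open>a \<noteq> b\<close>; on the diagonal the quotients
  defining \<open>log_mean\<close> and \<open>neuman_sandor_mean\<close> take the junk value \<open>0\<close>.\<close>

definition log_mean :: "real \<Rightarrow> real \<Rightarrow> real" where
  "log_mean a b = (a - b) / (ln a - ln b)"

definition neuman_sandor_mean :: "real \<Rightarrow> real \<Rightarrow> real" where
  "neuman_sandor_mean a b = (a - b) / (2 * arsinh ((a - b) / (a + b)))"

definition arith_mean :: "real \<Rightarrow> real \<Rightarrow> real" where
  "arith_mean a b = (a + b) / 2"

definition geom_mean :: "real \<Rightarrow> real \<Rightarrow> real" where
  "geom_mean a b = sqrt (a * b)"

definition quad_mean :: "real \<Rightarrow> real \<Rightarrow> real" where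
  "quad_mean a b = sqrt ((a\<^sup>2 + b\<^sup>2) / 2)"

end

theory Submission
  imports Defs
begin

text \<open>
  Both inequalities are one inequality in disguise. Writing \<open>a = G e\<^sup>t\<close> and \<open>b = G e\<^sup>-\<^sup>t\<close> gives
  \<open>A = G cosh t\<close> and \<open>L = G sinh t / t\<close>, while \<open>sinh u = (a - b) / (a + b)\<close> gives \<open>Q = A cosh u\<close>
  and \<open>NS = A sinh u / u\<close>; as these expressions are even, \<open>t\<close> and \<open>u\<close> may be taken positive.
  By homogeneity, the question in either case is how
  \<open>(2 + (1 + 3p) c) / (3 + p + 2p c)\<close> with \<open>c = cosh t\<close> compares with \<open>sinh t / t\<close>. The first
  inequality covers all \<open>t > 0\<close>, the second one only \<open>0 < t < arsinh 1\<close>, so every counterexample can be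
  taken from the first.

  For \<open>p \<ge> 0\<close> the comparison is that of
  \<open>sinh t (3 + p + 2p c) / (2 + (1 + 3p) c)\<close> with \<open>t\<close>. The two agree at \<open>0\<close>, and their difference
  has a derivative with the sign of \<open>2p (1 + 3p) c + 3p\<^sup>2 + 6p - 1\<close>
  (lemma \<open>has_real_derivative_cusa_gap\<close>). At \<open>c = 1\<close> this factor is \<open>(9p - 1) (p + 1)\<close>, which is where the
  threshold \<open>1/9\<close> comes from: for \<open>p \<ge> 1/9\<close> the factor is positive on \<open>c > 1\<close>; for
  \<open>0 < p < 1/9\<close> it is negative at first, so the inequality fails for small \<open>t\<close>; for \<open>p = 0\<close> it is
  the constant \<open>-1\<close>, so the reversed inequality holds throughout. For \<open>p > 0\<close> the quotient stays
  bounded while \<open>sinh t / t\<close> does not, so the reversed inequality fails for large \<open>t\<close>. For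
  \<open>p \<le> -1\<close> the quotient is smaller than the one for \<open>p = 1/9\<close>, so this case follows from that one.
\<close>

definition cusa_quot :: "real \<Rightarrow> real \<Rightarrow> real" where
  "cusa_quot p c = (2 + (1 + 3 * p) * c) / ((3 + p) + 2 * p * c)"

text \<open>This is \<open>t\<close> times the relative difference of \<open>sinh t / t\<close> and the quotient at \<open>cosh t\<close>. Isolating
  the bare \<open>t\<close> makes its derivative a rational function of \<open>cosh t\<close> alone.\<close>

definition cusa_gap :: "real \<Rightarrow> real \<Rightarrow> real" where
  "cusa_gap p t = sinh t * ((3 + p) + 2 * p * cosh t) / (2 + (1 + 3 * p) * cosh t) - t"

section \<open>The hyperbolic inequality\<close>

lemma cosh_real_gt_1:
  fixes t :: real
  assumes "t > 0"
  shows "cosh t > 1"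
  using cosh_real_strict_mono[of 0 t] assms by simp

lemma cusa_gap_pos_iff:
  assumes "p \<ge> 0" "t > 0"
  shows "cusa_gap p t > 0 \<longleftrightarrow> cusa_quot p (cosh t) < sinh t / t"
    and "cusa_gap p t < 0 \<longleftrightarrow> cusa_quot p (cosh t) > sinh t / t"
proof -
  have c: "cosh t > 0" by simp
  have N: "2 + (1 + 3 * p) * cosh t > 0"
    using assms c by (intro add_pos_nonneg mult_nonneg_nonneg) auto
  have D: "(3 + p) + 2 * p * cosh t > 0"
    using assms c by (intro add_pos_nonneg) auto
  show "cusa_gap p t > 0 \<longleftrightarrow> cusa_quot p (cosh t) < sinh t / t"
    and "cusa_gap p t < 0 \<longleftrightarrow> cusa_quot p (cosh t) > sinh t / t"
    using N D assms(2) by (simp_all add: cusa_gap_def cusa_quot_def field_simps)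
qed

text \<open>After \<open>sinh\<^sup>2 = cosh\<^sup>2 - 1\<close> the numerator is a polynomial in \<open>c = cosh t\<close>. Its double root at
  \<open>c = 1\<close> reflects that \<open>sinh t / t\<close> and the quotient agree to order \<open>t\<^sup>2\<close> for every \<open>p\<close>.\<close>

lemma has_real_derivative_cusa_gap:
  assumes "p \<ge> 0"
  shows "(cusa_gap p has_real_derivative
           (cosh t - 1)\<^sup>2 * (2 * p * (1 + 3 * p) * cosh t + 3 * p\<^sup>2 + 6 * p - 1)
             / (2 + (1 + 3 * p) * cosh t)\<^sup>2) (at t)"
proof -
  define c where "c = cosh t"
  define s where "s = sinh t"
  have s2: "s * s = c\<^sup>2 - 1"
    using cosh_square_eq[of t] by (simp add: c_def s_def power2_eq_square)
  have "cosh t > 0" by simp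
  then have N: "2 + (1 + 3 * p) * c > 0"
    unfolding c_def using assms by (intro add_pos_nonneg mult_nonneg_nonneg) auto
  have "(cusa_gap p has_real_derivative
      ((c * ((3 + p) + 2 * p * c) + s * (2 * p * s)) * (2 + (1 + 3 * p) * c)
        - s * ((3 + p) + 2 * p * c) * ((1 + 3 * p) * s)) / (2 + (1 + 3 * p) * c)\<^sup>2 - 1) (at t)"
    unfolding cusa_gap_def[abs_def] using N
    by (auto intro!: derivative_eq_intros simp: c_def s_def power2_eq_square algebra_simps)
  also have "(c * ((3 + p) + 2 * p * c) + s * (2 * p * s)) * (2 + (1 + 3 * p) * c)
        - s * ((3 + p) + 2 * p * c) * ((1 + 3 * p) * s)
      = (c * ((3 + p) + 2 * p * c) + 2 * p * (s * s)) * (2 + (1 + 3 * p) * c)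
        - (s * s) * ((3 + p) + 2 * p * c) * (1 + 3 * p)"
    by (simp add: algebra_simps)
  also have "\<dots> = (c - 1)\<^sup>2 * (2 * p * (1 + 3 * p) * c + 3 * p\<^sup>2 + 6 * p - 1)
      + (2 + (1 + 3 * p) * c)\<^sup>2"
    unfolding s2 by (simp add: power2_eq_square algebra_simps)
  finally show ?thesis
    using N by (simp add: c_def[symmetric] add_divide_distrib)
qed

lemma cusa_quot_less_of_ge:
  assumes p: "p \<ge> 1 / 9" and t: "t > 0"
  shows "cusa_quot p (cosh t) < sinh t / t"
proof -
  have p0: "p \<ge> 0" using p by simp
  have "cusa_gap p 0 < cusa_gap p t"
  proof (rule DERIV_pos_imp_increasing_open[OF t])
    fix x :: real
    assume "0 < x" "x < t"
    then have c: "cosh x > 1" by (intro cosh_real_gt_1)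
    have "2 * p * (1 + 3 * p) * 1 < 2 * p * (1 + 3 * p) * cosh x"
      using c p by (intro mult_strict_left_mono) auto
    moreover have "2 * p * (1 + 3 * p) * 1 + 3 * p\<^sup>2 + 6 * p - 1 = (9 * p - 1) * (p + 1)"
      by (simp add: power2_eq_square algebra_simps)
    moreover have "(9 * p - 1) * (p + 1) \<ge> 0"
      using p by (intro mult_nonneg_nonneg) auto
    ultimately have "2 * p * (1 + 3 * p) * cosh x + 3 * p\<^sup>2 + 6 * p - 1 > 0" by linarith
    moreover have "2 + (1 + 3 * p) * cosh x > 0"
      using p c by (intro add_pos_nonneg mult_nonneg_nonneg) auto
    ultimately have "(cosh x - 1)\<^sup>2 * (2 * p * (1 + 3 * p) * cosh x + 3 * p\<^sup>2 + 6 * p - 1)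
             / (2 + (1 + 3 * p) * cosh x)\<^sup>2 > 0"
      using c by (intro divide_pos_pos mult_pos_pos) auto
    then show "\<exists>y. (cusa_gap p has_real_derivative y) (at x) \<and> y > 0"
      using has_real_derivative_cusa_gap[OF p0] by blast
  next
    show "continuous_on {0..t} (cusa_gap p)"
      by (intro continuous_at_imp_continuous_on ballI DERIV_isCont[OF has_real_derivative_cusa_gap[OF p0]])
  qed
  then show ?thesis
    using cusa_gap_pos_iff[OF p0 t] by (simp add: cusa_gap_def)
qed

text \<open>Controlling the linear factor at the endpoint \<open>t\<close> is enough: \<open>cosh\<close> is increasing, so the factor,
  and with it the derivative of the gap, is negative on all of \<open>(0, t)\<close>.\<close>

lemma cusa_quot_greater_of_factor_nonpos:
  assumes p: "p \<ge> 0" and t: "t > 0"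
    and factor: "2 * p * (1 + 3 * p) * cosh t + 3 * p\<^sup>2 + 6 * p - 1 \<le> 0"
  shows "cusa_quot p (cosh t) > sinh t / t"
proof -
  have "cusa_gap p 0 > cusa_gap p t"
  proof (rule DERIV_neg_imp_decreasing_open[OF t])
    fix x :: real
    assume x: "0 < x" "x < t"
    then have c: "cosh x > 1" by (intro cosh_real_gt_1)
    have "2 * p * (1 + 3 * p) * cosh x + 3 * p\<^sup>2 + 6 * p - 1 < 0"
    proof (cases "p = 0")
      case False
      have "cosh x < cosh t" using x by (intro cosh_real_strict_mono) auto
      then have "2 * p * (1 + 3 * p) * cosh x < 2 * p * (1 + 3 * p) * cosh t"
        using p False by (intro mult_strict_left_mono) auto
      then show ?thesis using factor by linarith
    qed simp
    moreover have "2 + (1 + 3 * p) * cosh x > 0"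
      using p c by (intro add_pos_nonneg mult_nonneg_nonneg) auto
    ultimately have "(cosh x - 1)\<^sup>2 * (2 * p * (1 + 3 * p) * cosh x + 3 * p\<^sup>2 + 6 * p - 1)
             / (2 + (1 + 3 * p) * cosh x)\<^sup>2 < 0"
      using c by (intro divide_neg_pos mult_pos_neg) auto
    then show "\<exists>y. (cusa_gap p has_real_derivative y) (at x) \<and> y < 0"
      using has_real_derivative_cusa_gap[OF p] by blast
  next
    show "continuous_on {0..t} (cusa_gap p)"
      by (intro continuous_at_imp_continuous_on ballI DERIV_isCont[OF has_real_derivative_cusa_gap[OF p]])
  qed
  then show ?thesis
    using cusa_gap_pos_iff[OF p t] by (simp add: cusa_gap_def)
qed

text \<open>The difference of the two quotients is \<open>2 (1/9 - p) (c - 1)\<^sup>2\<close> over the product of their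
  denominators; for \<open>p \<le> -1\<close> the denominator \<open>3 + p (1 + 2c)\<close> is negative.\<close>

lemma cusa_quot_less_ninth:
  assumes p: "p \<le> -1" and c: "c > 1"
  shows "cusa_quot p c < cusa_quot (1 / 9) c"
proof -
  have "p * (1 + 2 * c) \<le> -1 * (1 + 2 * c)"
    using p c by (intro mult_right_mono) auto
  then have D: "(3 + p) + 2 * p * c < 0"
    using c by (simp add: algebra_simps)
  have E: "(3 + 1 / 9) + 2 * (1 / 9) * c > 0"
    using c by simp
  have cross: "(2 + (1 + 3 * p) * c) * ((3 + q) + 2 * q * c) - (2 + (1 + 3 * q) * c) * ((3 + p) + 2 * p * c)
      = 2 * (q - p) * (c - 1)\<^sup>2" for q
    by (simp add: power2_eq_square algebra_simps)
  have "cusa_quot p c - cusa_quot (1 / 9) c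
      = 2 * (1 / 9 - p) * (c - 1)\<^sup>2 / (((3 + p) + 2 * p * c) * ((3 + 1 / 9) + 2 * (1 / 9) * c))"
    unfolding cusa_quot_def using D E
    by (simp only: diff_frac_eq[OF less_imp_neq[OF D] less_imp_neq[OF E, symmetric]] cross)
  also have "\<dots> < 0"
    using p c D E by (intro divide_pos_neg mult_pos_pos mult_neg_pos) auto
  finally show ?thesis by simp
qed

lemma cusa_quot_less:
  assumes "p \<in> {..-1} \<union> {1/9..}" "t > 0"
  shows "cusa_quot p (cosh t) < sinh t / t"
  using assms cusa_quot_less_of_ge[of p t] cusa_quot_less_of_ge[of "1 / 9" t]
    cusa_quot_less_ninth[of p "cosh t"] cosh_real_gt_1[of t] by fastforce

lemma cusa_quot_0_greater:
  assumes "t > 0"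
  shows "cusa_quot 0 (cosh t) > sinh t / t"
  using assms by (intro cusa_quot_greater_of_factor_nonpos) auto

lemma ex_cusa_quot_greater:
  assumes p: "0 \<le> p" "p < 1 / 9"
  shows "\<exists>t>0. cusa_quot p (cosh t) > sinh t / t"
proof (cases "p = 0")
  case True
  then show ?thesis using cusa_quot_0_greater[of 1] by (intro exI[of _ 1]) simp
next
  case False
  \<comment> \<open>\<open>1 + d\<close> is the root of the linear factor, so \<open>t\<close> is where the gap has its minimum.\<close>
  define d where "d = (1 - 9 * p) * (p + 1) / (2 * p * (1 + 3 * p))"
  define t where "t = arcosh (1 + d)"
  have p': "p > 0" using p False by simp
  have d: "d > 0"
    unfolding d_def using p' p by (intro divide_pos_pos mult_pos_pos) auto
  have t: "t > 0" unfolding t_def using d by simp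
  have ct: "cosh t = 1 + d" unfolding t_def using d by simp
  have "2 * p * (1 + 3 * p) * d = (1 - 9 * p) * (p + 1)"
    unfolding d_def using p' by simp
  then have "2 * p * (1 + 3 * p) * (1 + d) + 3 * p\<^sup>2 + 6 * p - 1 = 0"
    by (simp add: power2_eq_square algebra_simps)
  then show ?thesis
    using cusa_quot_greater_of_factor_nonpos[OF p(1) t] t ct by auto
qed

lemma sinh_ge_square:
  fixes t :: real
  assumes "t \<ge> 0"
  shows "t\<^sup>2 / 4 + t / 2 \<le> sinh t"
proof -
  have "1 + t + t\<^sup>2 / 2 \<le> exp t" using assms by (rule exp_lower_Taylor_quadratic)
  moreover have "exp t - 1 \<le> 2 * sinh t" using assms by (simp add: sinh_field_def)
  ultimately show ?thesis by linarith
qed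

lemma ex_cusa_quot_less:
  assumes p: "p > 0"
  shows "\<exists>t>0. cusa_quot p (cosh t) < sinh t / t"
proof -
  \<comment> \<open>\<open>(1 + 3p) / (2p)\<close> is the limit of the quotient for \<open>c \<rightarrow> \<infinity>\<close> and bounds it from above, and
     \<open>sinh t / t > t / 4\<close>.\<close>
  define t where "t = 2 * (1 + 3 * p) / p"
  have t: "t > 0" unfolding t_def using p by simp
  have c: "cosh t > 0" by simp
  have "cusa_quot p (cosh t) \<le> (1 + 3 * p) / (2 * p)"
  proof -
    have D: "(3 + p) + 2 * p * cosh t > 0"
      using p c by (intro add_pos_pos mult_pos_pos) auto
    have "(1 + 3 * p) * ((3 + p) + 2 * p * cosh t) - (2 + (1 + 3 * p) * cosh t) * (2 * p)
        = 3 + 6 * p + 3 * p\<^sup>2"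
      by (simp add: power2_eq_square algebra_simps)
    also have "\<dots> \<ge> 0" using p by simp
    finally show ?thesis
      unfolding cusa_quot_def using D p by (simp add: divide_le_eq pos_le_divide_eq)
  qed
  also have "\<dots> = t / 4" unfolding t_def using p by (simp add: field_simps)
  also have "\<dots> < sinh t / t"
    using sinh_ge_square[of t] t by (simp add: pos_less_divide_eq power2_eq_square)
  finally show ?thesis using t by blast
qed

section \<open>Hyperbolic parametrization of the means\<close>

text \<open>Here \<open>x\<close> is the smaller of the two means in a quotient, \<open>G\<close> or \<open>A\<close>, and \<open>x * c\<close> the larger one,
  \<open>A\<close> or \<open>Q\<close>.\<close>

lemma cusa_quot_homogeneous:
  assumes "x > 0"
  shows "(2 * x + (1 + 3 * p) * (x * c)) / ((3 + p) * x + 2 * p * (x * c)) * x = x * cusa_quot p c"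
proof -
  have "2 * x + (1 + 3 * p) * (x * c) = x * (2 + (1 + 3 * p) * c)"
    and "(3 + p) * x + 2 * p * (x * c) = x * ((3 + p) + 2 * p * c)"
    by (simp_all add: algebra_simps)
  then show ?thesis using assms by (simp add: cusa_quot_def)
qed

lemma cosh_sinh_quot_abs:
  fixes v :: real
  shows "cosh \<bar>v\<bar> = cosh v" "sinh \<bar>v\<bar> / \<bar>v\<bar> = sinh v / v"
  by (cases "v \<ge> 0"; simp)+

lemma log_mean_hyperbolic:
  assumes ab: "a > 0" "b > 0" "a \<noteq> b"
  obtains t where "t > 0" "geom_mean a b > 0"
    "arith_mean a b = geom_mean a b * cosh t" "log_mean a b = geom_mean a b * (sinh t / t)"
proof
  define v where "v = (ln a - ln b) / 2"
  define g where "g = geom_mean a b"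
  show "\<bar>v\<bar> > 0" unfolding v_def using ab by simp
  show "geom_mean a b > 0" unfolding geom_mean_def using ab by simp
  have g: "g = exp ((ln a + ln b) / 2)"
  proof -
    have "(exp ((ln a + ln b) / 2))\<^sup>2 = exp (ln a + ln b)"
      unfolding power2_eq_square exp_add[symmetric] by simp
    also have "\<dots> = a * b" using ab by (simp add: exp_add)
    finally have "(exp ((ln a + ln b) / 2))\<^sup>2 = a * b" .
    then show ?thesis
      unfolding g_def geom_mean_def by (metis exp_ge_zero real_sqrt_unique)
  qed
  have "g * exp v = exp (ln a)" "g * exp (- v) = exp (ln b)"
    unfolding g v_def exp_add[symmetric] by (simp_all add: field_simps)
  then have e: "g * exp v = a" "g * exp (- v) = b" using ab by simp_all
  have "g * cosh v = (g * exp v + g * exp (- v)) / 2"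
    and "g * sinh v = (g * exp v - g * exp (- v)) / 2"
    by (simp_all add: cosh_field_def sinh_field_def algebra_simps)
  then have cs: "g * cosh v = (a + b) / 2" "g * sinh v = (a - b) / 2"
    unfolding e by simp_all
  show "arith_mean a b = geom_mean a b * cosh \<bar>v\<bar>"
    using cs by (simp add: arith_mean_def g_def)
  have "g * (sinh v / v) = (a - b) / 2 / v" by (simp only: cs(2)[symmetric] times_divide_eq_right)
  also have "\<dots> = log_mean a b"
    using ab by (simp add: log_mean_def v_def divide_simps) (simp add: algebra_simps)
  finally show "log_mean a b = geom_mean a b * (sinh \<bar>v\<bar> / \<bar>v\<bar>)"
    by (simp only: cosh_sinh_quot_abs g_def)
qed

lemma neuman_sandor_mean_hyperbolic:
  assumes ab: "a > 0" "b > 0" "a \<noteq> b"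
  obtains t where "t > 0" "arith_mean a b > 0"
    "quad_mean a b = arith_mean a b * cosh t"
    "neuman_sandor_mean a b = arith_mean a b * (sinh t / t)"
proof
  define x where "x = (a - b) / (a + b)"
  define m where "m = arith_mean a b"
  define v where "v = arsinh x"
  have x0: "x \<noteq> 0" unfolding x_def using ab by simp
  have sv: "sinh v = x" unfolding v_def by simp
  have "v \<noteq> 0" using sv x0 by auto
  then show "\<bar>v\<bar> > 0" by simp
  show m0: "arith_mean a b > 0" unfolding arith_mean_def using ab by simp
  have "a + b \<noteq> 0" using ab by simp
  then have mx: "m * x = (a - b) / 2" unfolding m_def arith_mean_def x_def by (simp add: divide_simps)
  have "(m * cosh v)\<^sup>2 = m\<^sup>2 + (m * x)\<^sup>2"
    using cosh_square_eq[of v] by (simp add: sv power_mult_distrib algebra_simps)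
  also have "\<dots> = (a\<^sup>2 + b\<^sup>2) / 2"
    unfolding mx by (simp add: m_def arith_mean_def power2_eq_square field_simps)
  finally have "quad_mean a b = m * cosh v"
    unfolding quad_mean_def using m0 by (intro real_sqrt_unique) (auto simp: m_def)
  then show "quad_mean a b = arith_mean a b * cosh \<bar>v\<bar>"
    by (simp add: m_def)
  have "m * (sinh v / v) = (a - b) / 2 / v" by (simp only: mx[symmetric] sv times_divide_eq_right)
  also have "\<dots> = neuman_sandor_mean a b"
    by (simp add: neuman_sandor_mean_def v_def x_def)
  finally show "neuman_sandor_mean a b = arith_mean a b * (sinh \<bar>v\<bar> / \<bar>v\<bar>)"
    by (simp only: cosh_sinh_quot_abs m_def)
qed

lemma means_exp:
  "geom_mean (exp t) (exp (- t)) = 1" "arith_mean (exp t) (exp (- t)) = cosh t"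
    "log_mean (exp t) (exp (- t)) = sinh t / t"
  by (simp_all add: geom_mean_def arith_mean_def log_mean_def cosh_field_def sinh_field_def
      flip: exp_add)

section \<open>The two equivalences\<close>


theorem proposition5:
  fixes p :: real
  assumes "p \<in> {..-1} \<union> {0..}"
  shows
    "((\<forall>a b. a > 0 \<and> b > 0 \<and> a \<noteq> b \<longrightarrow>
         (2 * geom_mean a b + (1 + 3 * p) * arith_mean a b) /
           ((3 + p) * geom_mean a b + 2 * p * arith_mean a b) * geom_mean a b
           < log_mean a b \<and>
         (2 * arith_mean a b + (1 + 3 * p) * quad_mean a b) /
           ((3 + p) * arith_mean a b + 2 * p * quad_mean a b) * arith_mean a b
           < neuman_sandor_mean a b)
       \<longleftrightarrow> p \<in> {..-1} \<union> {1/9..})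
     \<and>
     ((\<forall>a b. a > 0 \<and> b > 0 \<and> a \<noteq> b \<longrightarrow>
         (2 * geom_mean a b + (1 + 3 * p) * arith_mean a b) /
           ((3 + p) * geom_mean a b + 2 * p * arith_mean a b) * geom_mean a b
           > log_mean a b \<and>
         (2 * arith_mean a b + (1 + 3 * p) * quad_mean a b) /
           ((3 + p) * arith_mean a b + 2 * p * quad_mean a b) * arith_mean a b
           > neuman_sandor_mean a b)
       \<longleftrightarrow> p = 0)"
proof -
  let ?X = "\<lambda>a b. (2 * geom_mean a b + (1 + 3 * p) * arith_mean a b) /
           ((3 + p) * geom_mean a b + 2 * p * arith_mean a b) * geom_mean a b"
  let ?Y = "\<lambda>a b. (2 * arith_mean a b + (1 + 3 * p) * quad_mean a b) /
           ((3 + p) * arith_mean a b + 2 * p * quad_mean a b) * arith_mean a b"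
  have less: "?X a b < log_mean a b \<and> ?Y a b < neuman_sandor_mean a b"
    if H: "\<And>t. t > 0 \<Longrightarrow> cusa_quot p (cosh t) < sinh t / t"
      and ab: "a > 0" "b > 0" "a \<noteq> b" for a b
  proof
    show "?X a b < log_mean a b"
      using ab by (rule log_mean_hyperbolic)
        (simp only: cusa_quot_homogeneous H mult_less_cancel_left_pos)
    show "?Y a b < neuman_sandor_mean a b"
      using ab by (rule neuman_sandor_mean_hyperbolic)
        (simp only: cusa_quot_homogeneous H mult_less_cancel_left_pos)
  qed
  have greater: "?X a b > log_mean a b \<and> ?Y a b > neuman_sandor_mean a b"
    if H: "\<And>t. t > 0 \<Longrightarrow> cusa_quot p (cosh t) > sinh t / t"
      and ab: "a > 0" "b > 0" "a \<noteq> b" for a b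
  proof
    show "?X a b > log_mean a b"
      using ab by (rule log_mean_hyperbolic)
        (simp only: cusa_quot_homogeneous H mult_less_cancel_left_pos)
    show "?Y a b > neuman_sandor_mean a b"
      using ab by (rule neuman_sandor_mean_hyperbolic)
        (simp only: cusa_quot_homogeneous H mult_less_cancel_left_pos)
  qed
  have X_exp: "?X (exp t) (exp (- t)) = cusa_quot p (cosh t)"
    "log_mean (exp t) (exp (- t)) = sinh t / t"
    "exp t > 0 \<and> exp (- t) > 0 \<and> exp t \<noteq> exp (- t)" if "t > 0" for t
    using that by (simp_all add: means_exp cusa_quot_def)
  show ?thesis
  proof (intro conjI iffI)
    assume "\<forall>a b. a > 0 \<and> b > 0 \<and> a \<noteq> b \<longrightarrow>
      ?X a b < log_mean a b \<and> ?Y a b < neuman_sandor_mean a b"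
    then have "\<And>t. t > 0 \<Longrightarrow> cusa_quot p (cosh t) < sinh t / t"
      using X_exp by metis
    then have "\<not> (0 \<le> p \<and> p < 1 / 9)"
      using ex_cusa_quot_greater[of p] by (meson less_asym)
    then show "p \<in> {..-1} \<union> {1/9..}" using assms by auto
  next
    assume "p \<in> {..-1} \<union> {1/9..}"
    then show "\<forall>a b. a > 0 \<and> b > 0 \<and> a \<noteq> b \<longrightarrow>
      ?X a b < log_mean a b \<and> ?Y a b < neuman_sandor_mean a b"
      using less cusa_quot_less by blast
  next
    assume "\<forall>a b. a > 0 \<and> b > 0 \<and> a \<noteq> b \<longrightarrow>
      ?X a b > log_mean a b \<and> ?Y a b > neuman_sandor_mean a b"
    then have gr: "\<And>t. t > 0 \<Longrightarrow> cusa_quot p (cosh t) > sinh t / t"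
      using X_exp by metis
    have "\<not> p > 0"
      using gr ex_cusa_quot_less[of p] by (meson less_asym)
    moreover have "\<not> p \<le> -1"
      using gr[of 1] cusa_quot_less[of p 1] by auto
    ultimately show "p = 0" using assms by auto
  next
    assume "p = 0"
    then show "\<forall>a b. a > 0 \<and> b > 0 \<and> a \<noteq> b \<longrightarrow>
      ?X a b > log_mean a b \<and> ?Y a b > neuman_sandor_mean a b"
      using greater cusa_quot_0_greater by blast
  qed
qed

end
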